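(* The maps $\rho_i:\mathcal{A}_n\to\mathcal{A}_n$, $0\le i\le n-2$, when extended multiplicatively (i.e. letting the generator $s_i$ act by $\rho_i$), determine a well-defined $\widetilde C_{n-2}$-action on the set of arc permutations $\mathcal{A}_n$.
   Context: An interval in $\mathbb{Z}_n$ is a subset of $\{1,\dots,n\}$ of the form $[a,b]$ or $[b,n]\cup[1,a]$ with $1\le a\le b\le n$. $\mathcal{A}_n$ is the set of arc permutations: those $\pi$ in the symmetric group $\mathcal{S}_n$ such that for every $1\le j\le n$ the set $\{\pi(1),\dots,\pi(j)\}$ of the first $j$ letters of $\pi$ is an interval in $\mathbb{Z}_n$. Let $\sigma_i=(i,i+1)$ be the adjacent transposition, with $\pi\sigma_i$ obtained from $\pi$ by exchanging the letters in positions $i$ and $i+1$. For $0\le i\le n-2$, the map $\rho_i:\mathcal{A}_n\to\mathcal{A}_n$ is defined by $\rho_i(\pi)=\pi\sigma_{i+1}$ if $\pi\sigma_{i+1}\in\mathcal{A}_n$, and $\rho_i(\pi)=\pi$ otherwise. The affine Weyl group $\widetilde C_{n-2}$ is generated by $s_0,s_1,\dots,s_{n-2}$ subject to the Coxeter relations: $s_i^2=1$ for all $i$; $(s_is_j)^2=1$ for $|j-i|>1$; $(s_is_{i+1})^3=1$ for $1\le i<n-3$; $(s_is_{i+1})^4=1$ for $i=0,n-3$.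
   Formalization: Stated for n ≥ 4: for n = 3 the displayed relation (s_0 s_1)^4 = 1 fails, since A_3 = S_3 and ρ_0ρ_1 has order 3; for n ≤ 2 the relations of order 4 name generators that do not exist. *)

theory Defs
  imports "HOL-Algebra.Group_Action" "HOL-Combinatorics.Permutations"
begin

text \<open>A letter \<open>(x, True)\<close> stands for the generator \<open>x\<close>, and \<open>(x, False)\<close> for its inverse.\<close>

type_synonym 'a gword = "('a \<times> bool) list"

definition gwords :: "'a set \<Rightarrow> 'a gword set" where
  "gwords S = lists (S \<times> UNIV)"

inductive_set pres_rel :: "'a set \<Rightarrow> 'a gword set \<Rightarrow> ('a gword \<times> 'a gword) set"
  for S :: "'a set" and R :: "'a gword set" where
  refl: "u \<in> gwords S \<Longrightarrow> (u, u) \<in> pres_rel S R"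
| sym: "(u, v) \<in> pres_rel S R \<Longrightarrow> (v, u) \<in> pres_rel S R"
| trans: "(u, v) \<in> pres_rel S R \<Longrightarrow> (v, w) \<in> pres_rel S R \<Longrightarrow> (u, w) \<in> pres_rel S R"
| cancel: "u \<in> gwords S \<Longrightarrow> v \<in> gwords S \<Longrightarrow> x \<in> S \<Longrightarrow>
    (u @ [(x, e), (x, \<not> e)] @ v, u @ v) \<in> pres_rel S R"
| relator: "u \<in> gwords S \<Longrightarrow> v \<in> gwords S \<Longrightarrow> r \<in> R \<Longrightarrow> r \<in> gwords S \<Longrightarrow>
    (u @ r @ v, u @ v) \<in> pres_rel S R"

text \<open>The group \<open>\<langle>S | r = 1 for r \<in> R\<rangle>\<close>. The union in the multiplication ranges over
  all representatives of the two classes.\<close>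

definition presented_group :: "'a set \<Rightarrow> 'a gword set \<Rightarrow> 'a gword set monoid" where
  "presented_group S R =
    \<lparr>carrier = gwords S // pres_rel S R,
     monoid.mult = (\<lambda>X Y. \<Union>u\<in>X. \<Union>v\<in>Y. pres_rel S R `` {u @ v}),
     monoid.one = pres_rel S R `` {[]}\<rparr>"

definition pres_gen :: "'a set \<Rightarrow> 'a gword set \<Rightarrow> 'a \<Rightarrow> 'a gword set" where
  "pres_gen S R x = pres_rel S R `` {[(x, True)]}"

definition power_relator :: "'a \<Rightarrow> 'a \<Rightarrow> nat \<Rightarrow> 'a gword" where
  "power_relator x y k = concat (replicate k [(x, True), (y, True)])"

text \<open>The relators below describe the affine Weyl group of type \<open>C\<close> and rank \<open>m\<close> only for
  \<open>m \<ge> 2\<close>. The truncated subtraction \<open>m - 1\<close> is then harmless.\<close>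

definition affine_C_relators :: "nat \<Rightarrow> nat gword set" where
  "affine_C_relators m =
     {[(i, True), (i, True)] | i. i \<le> m}
   \<union> {power_relator i j 2 | i j. i \<le> m \<and> j \<le> m \<and> \<bar>int j - int i\<bar> > 1}
   \<union> {power_relator i (i + 1) 3 | i. 1 \<le> i \<and> i < m - 1}
   \<union> {power_relator i (i + 1) 4 | i. i = 0 \<or> i = m - 1}"

definition affine_C :: "nat \<Rightarrow> nat gword set monoid" where
  "affine_C m = presented_group {0..m} (affine_C_relators m)"

definition affine_C_gen :: "nat \<Rightarrow> nat \<Rightarrow> nat gword set" where
  "affine_C_gen m i = pres_gen {0..m} (affine_C_relators m) i"

definition cyclic_interval :: "nat \<Rightarrow> nat set \<Rightarrow> bool" where
  "cyclic_interval n I \<longleftrightarrow>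
    (\<exists>a b. 1 \<le> a \<and> a \<le> b \<and> b \<le> n \<and> (I = {a..b} \<or> I = {b..n} \<union> {1..a}))"

definition arc_permutations :: "nat \<Rightarrow> (nat \<Rightarrow> nat) set" where
  "arc_permutations n =
    {\<pi>. \<pi> permutes {1..n} \<and> (\<forall>j\<in>{1..n}. cyclic_interval n (\<pi> ` {1..j}))}"

definition rho :: "nat \<Rightarrow> nat \<Rightarrow> (nat \<Rightarrow> nat) \<Rightarrow> (nat \<Rightarrow> nat)" where
  "rho n i \<pi> =
    (let \<pi>' = \<pi> \<circ> transpose (i + 1) (i + 2)
     in if \<pi>' \<in> arc_permutations n then \<pi>' else \<pi>)"

end

(*
  By the universal property of a presentation it suffices that the involutions rho_i satisfy the
  Coxeter relations. Swapping two adjacent letters only changes one prefix set, so rho_i and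
  rho_j commute when |i - j| > 1. For adjacent indices fix the set I of the first i letters; the
  two maps permute the next three letters. If I is a nonempty arc missing at least four letters,
  each new letter is attached to the left or the right end of the current arc, so the orbits are
  the classes of words of length three in L and R under adjacent exchanges: they have one or
  three elements, and the product has order dividing 3. If I is empty or misses only three
  letters, these letters form a proper arc, of whose three pairs exactly two are arcs. The orbit
  is then a path with four vertices, and the product has order dividing 4.
*)

theory Submission
  imports Defs
begin

section \<open>The group of a presentation: words modulo the congruence generated by cancellations
  and relators\<close>

section \<open>Group presentations\<close>

lemma gwords_Nil [simp]: "[] \<in> gwords S"
  and gwords_Cons [simp]: "l # u \<in> gwords S \<longleftrightarrow> fst l \<in> S \<and> u \<in> gwords S"
  and gwords_append [simp]: "u @ v \<in> gwords S \<longleftrightarrow> u \<in> gwords S \<and> v \<in> gwords S"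
  by (cases l; auto simp: gwords_def)+

lemma pres_rel_gwords:
  "(u, v) \<in> pres_rel S R \<Longrightarrow> u \<in> gwords S \<and> v \<in> gwords S"
  by (induction rule: pres_rel.induct) auto

lemma equiv_pres_rel: "equiv (gwords S) (pres_rel S R)"
  by (rule equivI)
     (auto simp: refl_on_def sym_def trans_def dest: pres_rel_gwords
       intro: pres_rel.refl pres_rel.sym pres_rel.trans)

text \<open>The rules \<open>cancel\<close> and \<open>relator\<close> already carry a left and a
  right context, which absorb \<open>p\<close> and \<open>q\<close>. This makes
  \<open>pres_rel\<close> a congruence for concatenation.\<close>

lemma pres_rel_append_context:
  assumes "(u, v) \<in> pres_rel S R" "p \<in> gwords S" "q \<in> gwords S"
  shows "(p @ u @ q, p @ v @ q) \<in> pres_rel S R"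
  using assms
proof (induction rule: pres_rel.induct)
  case (cancel u v x e)
  then show ?case
    using pres_rel.cancel[of "p @ u" S "v @ q" x e R] by simp
next
  case (relator u v r)
  then show ?case
    using pres_rel.relator[of "p @ u" S "v @ q" r R] by simp
qed (auto intro: pres_rel.refl pres_rel.sym pres_rel.trans)

lemma pres_rel_append:
  assumes "(u, u') \<in> pres_rel S R" "(v, v') \<in> pres_rel S R"
  shows "(u @ v, u' @ v') \<in> pres_rel S R"
  using pres_rel_append_context[OF assms(1), of "[]" v]
    pres_rel_append_context[OF assms(2), of u' "[]"]
    assms[THEN pres_rel_gwords] pres_rel.trans by fastforce

definition pres_class :: "'a set \<Rightarrow> 'a gword set \<Rightarrow> 'a gword \<Rightarrow> 'a gword set" where
  "pres_class S R u = pres_rel S R `` {u}"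

lemma pres_class_eq_iff:
  assumes "u \<in> gwords S" "v \<in> gwords S"
  shows "pres_class S R u = pres_class S R v \<longleftrightarrow> (u, v) \<in> pres_rel S R"
  unfolding pres_class_def by (rule eq_equiv_class_iff[OF equiv_pres_rel assms])

lemma pres_class_in_carrier:
  "u \<in> gwords S \<Longrightarrow> pres_class S R u \<in> carrier (presented_group S R)"
  by (auto simp: presented_group_def pres_class_def quotient_def)

lemma carrier_presented_groupE:
  assumes "X \<in> carrier (presented_group S R)"
  obtains u where "u \<in> gwords S" "X = pres_class S R u"
  using assms by (auto simp: presented_group_def pres_class_def quotient_def)

text \<open>By the congruence property all sets in the double union over representatives coincide.
  The union therefore collapses to one class, since neither index set is empty.\<close>

lemma presented_group_mult:
  assumes u: "u \<in> gwords S" and v: "v \<in> gwords S"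
  shows "pres_class S R u \<otimes>\<^bsub>presented_group S R\<^esub> pres_class S R v = pres_class S R (u @ v)"
proof -
  have "pres_class S R (u' @ v') = pres_class S R (u @ v)"
    if "u' \<in> pres_class S R u" "v' \<in> pres_class S R v" for u' v'
  proof -
    have "(u @ v, u' @ v') \<in> pres_rel S R"
      by (rule pres_rel_append) (use that in \<open>simp_all add: pres_class_def\<close>)
    then show ?thesis
      unfolding pres_class_def by (metis equiv_class_eq equiv_pres_rel)
  qed
  then have "(\<Union>u'\<in>pres_class S R u. \<Union>v'\<in>pres_class S R v. pres_class S R (u' @ v')) =
      (\<Union>u'\<in>pres_class S R u. \<Union>v'\<in>pres_class S R v. pres_class S R (u @ v))"
    by (simp cong: SUP_cong)
  moreover have "pres_class S R u \<noteq> {}" "pres_class S R v \<noteq> {}"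
    using pres_rel.refl[OF u] pres_rel.refl[OF v] by (auto simp: pres_class_def)
  ultimately show ?thesis
    by (simp add: presented_group_def pres_class_def)
qed

lemma presented_group_one: "\<one>\<^bsub>presented_group S R\<^esub> = pres_class S R []"
  by (simp add: presented_group_def pres_class_def)

definition gword_inv :: "'a gword \<Rightarrow> 'a gword" where
  "gword_inv u = rev (map (\<lambda>(x, e). (x, \<not> e)) u)"

lemma gword_inv_in_gwords: "u \<in> gwords S \<Longrightarrow> gword_inv u \<in> gwords S"
  by (induction u) (auto simp: gword_inv_def)

lemma gword_inv_cancel:
  "u \<in> gwords S \<Longrightarrow> (gword_inv u @ u, []) \<in> pres_rel S R"
proof (induction u)
  case Nil
  then show ?case by (simp add: gword_inv_def pres_rel.refl)
next
  case (Cons l u)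
  obtain x e where l: "l = (x, e)" by (cases l)
  \<comment> \<open>The rule \<open>cancel\<close> is used at the flag \<open>\<not> e\<close>, so
    that its second letter is the first letter of the given word.\<close>
  have "(gword_inv u @ [(x, \<not> e), (x, \<not> \<not> e)] @ u, gword_inv u @ u) \<in> pres_rel S R"
    using Cons.prems gword_inv_in_gwords by (intro pres_rel.cancel) (auto simp: l)
  then have "(gword_inv (l # u) @ l # u, gword_inv u @ u) \<in> pres_rel S R"
    by (simp add: l gword_inv_def)
  with Cons show ?case
    using pres_rel.trans by fastforce
qed

text \<open>A left unit and left inverses suffice for \<open>groupI\<close>; the left inverse of a
  class is the class of the formal inverse of a representative.\<close>

lemma group_presented_group: "group (presented_group S R)"
proof (rule groupI)
  fix X assume "X \<in> carrier (presented_group S R)"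
  then obtain u where u: "u \<in> gwords S" "X = pres_class S R u"
    by (rule carrier_presented_groupE)
  show "\<exists>Y\<in>carrier (presented_group S R). Y \<otimes>\<^bsub>presented_group S R\<^esub> X = \<one>\<^bsub>presented_group S R\<^esub>"
    by (rule bexI[of _ "pres_class S R (gword_inv u)"])
       (simp_all add: u gword_inv_in_gwords gword_inv_cancel presented_group_mult
         presented_group_one pres_class_in_carrier pres_class_eq_iff)
next
  fix X Y assume "X \<in> carrier (presented_group S R)" "Y \<in> carrier (presented_group S R)"
  then show "X \<otimes>\<^bsub>presented_group S R\<^esub> Y \<in> carrier (presented_group S R)"
    by (elim carrier_presented_groupE) (simp add: presented_group_mult pres_class_in_carrier)
next
  fix X Y Z assume "X \<in> carrier (presented_group S R)" "Y \<in> carrier (presented_group S R)"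
    "Z \<in> carrier (presented_group S R)"
  then show "X \<otimes>\<^bsub>presented_group S R\<^esub> Y \<otimes>\<^bsub>presented_group S R\<^esub> Z =
      X \<otimes>\<^bsub>presented_group S R\<^esub> (Y \<otimes>\<^bsub>presented_group S R\<^esub> Z)"
    by (elim carrier_presented_groupE) (simp add: presented_group_mult)
next
  fix X assume "X \<in> carrier (presented_group S R)"
  then show "\<one>\<^bsub>presented_group S R\<^esub> \<otimes>\<^bsub>presented_group S R\<^esub> X = X"
    by (elim carrier_presented_groupE) (simp add: presented_group_mult presented_group_one)
qed (simp add: presented_group_one pres_class_in_carrier)

section \<open>Evaluation of words and the universal property of a presentation\<close>

definition (in monoid) gword_val :: "('x \<Rightarrow> 'a) \<Rightarrow> 'x gword \<Rightarrow> 'a" where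
  "gword_val f u = foldr (\<lambda>(x, e) y. (if e then f x else inv (f x)) \<otimes> y) u \<one>"

context group
begin

lemma gword_val_Nil [simp]: "gword_val f [] = \<one>"
  and gword_val_Cons [simp]:
    "gword_val f ((x, e) # u) = (if e then f x else inv (f x)) \<otimes> gword_val f u"
  by (simp_all add: gword_val_def)

lemma gword_val_closed [simp, intro]:
  "f \<in> S \<rightarrow> carrier G \<Longrightarrow> u \<in> gwords S \<Longrightarrow> gword_val f u \<in> carrier G"
  by (induction u) (auto simp: Pi_iff)

lemma gword_val_append:
  assumes "f \<in> S \<rightarrow> carrier G" "u \<in> gwords S" "v \<in> gwords S"
  shows "gword_val f (u @ v) = gword_val f u \<otimes> gword_val f v"
  using assms(2)
proof (induction u)
  case (Cons l u)
  with assms show ?case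
    by (cases l) (auto simp: m_assoc Pi_iff gword_val_closed[OF assms(1)])
qed (use assms in auto)

text \<open>Cancelling pairs evaluate to the unit by the group laws and relators by hypothesis.
  Evaluation thus descends to classes of words.\<close>

lemma gword_val_pres_rel:
  assumes f: "f \<in> S \<rightarrow> carrier G"
    and R: "\<And>r. r \<in> R \<Longrightarrow> r \<in> gwords S \<Longrightarrow> gword_val f r = \<one>"
    and "(u, v) \<in> pres_rel S R"
  shows "gword_val f u = gword_val f v"
  using assms(3)
proof (induction rule: pres_rel.induct)
  case (cancel u v x e)
  have x: "f x \<in> carrier G" using f cancel by auto
  have "gword_val f ([(x, e), (x, \<not> e)]) = \<one>"
    using x by auto
  then show ?case
    using cancel f by (simp add: gword_val_append[OF f] gword_val_closed[OF f] m_assoc[symmetric] del: gword_val_Cons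
        append_Cons append_Nil)
next
  case (relator u v r)
  then show ?case
    using f R by (simp add: gword_val_append[OF f] gword_val_closed[OF f])
qed auto

text \<open>Existence comes from evaluating a representative, uniqueness from the fact that
  generators and their inverses yield every class. Extensionality fixes the values off the carrier,
  so that uniqueness is equality of functions.\<close>

theorem presented_group_universal:
  assumes f: "f \<in> S \<rightarrow> carrier G"
    and R: "\<And>r. r \<in> R \<Longrightarrow> r \<in> gwords S \<Longrightarrow> gword_val f r = \<one>"
  shows "\<exists>!h. h \<in> extensional (carrier (presented_group S R)) \<and>
    group_hom (presented_group S R) G h \<and> (\<forall>x\<in>S. h (pres_gen S R x) = f x)"
proof (rule ex_ex1I)
  define h where "h = (\<lambda>X\<in>carrier (presented_group S R). gword_val f (SOME u. u \<in> gwords S \<and> X = pres_class S R u))"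
  \<comment> \<open>The representative chosen by \<open>SOME\<close> is irrelevant, as equivalent
    words have the same value.\<close>
  have h: "h (pres_class S R u) = gword_val f u" if "u \<in> gwords S" for u
  proof -
    define v where "v = (SOME v. v \<in> gwords S \<and> pres_class S R u = pres_class S R v)"
    have "v \<in> gwords S \<and> pres_class S R u = pres_class S R v"
      unfolding v_def by (rule someI[of _ u]) (use that in simp)
    then have "gword_val f v = gword_val f u"
      using that gword_val_pres_rel[OF f R] by (auto simp: pres_class_eq_iff)
    with that show ?thesis
      by (simp add: h_def v_def pres_class_in_carrier)
  qed
  have "group_hom (presented_group S R) G h"
  proof (intro group_hom.intro group_presented_group is_group group_hom_axioms.intro homI)
    fix X assume "X \<in> carrier (presented_group S R)"
    then show "h X \<in> carrier G"
      by (elim carrier_presented_groupE) (use f in \<open>auto simp: h\<close>)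
  next
    fix X Y assume "X \<in> carrier (presented_group S R)" "Y \<in> carrier (presented_group S R)"
    then show "h (X \<otimes>\<^bsub>presented_group S R\<^esub> Y) = h X \<otimes> h Y"
      by (elim carrier_presented_groupE)
         (simp add: presented_group_mult h gword_val_append[OF f])
  qed
  moreover have "h (pres_gen S R x) = f x" if "x \<in> S" for x
    using h[of "[(x, True)]"] that funcset_mem[OF f] by (simp add: pres_gen_def pres_class_def)
  ultimately show "\<exists>h. h \<in> extensional (carrier (presented_group S R)) \<and>
      group_hom (presented_group S R) G h \<and> (\<forall>x\<in>S. h (pres_gen S R x) = f x)"
    by (intro exI[of _ h]) (auto simp: h_def)
next
  \<comment> \<open>Any homomorphism with the prescribed values on generators must be evaluation, by
    induction on the word.\<close>
  have val: "h (pres_class S R u) = gword_val f u"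
    if h: "group_hom (presented_group S R) G h" "\<forall>x\<in>S. h (pres_gen S R x) = f x"
      and "u \<in> gwords S" for h u
    using that(3)
  proof (induction u)
    case Nil
    then show ?case
      using group_hom.hom_one[OF h(1)] by (simp add: presented_group_one)
  next
    case (Cons l u)
    interpret h: group_hom "presented_group S R" G h by (rule h(1))
    obtain x e where l: "l = (x, e)" and x: "x \<in> S" using Cons.prems by (cases l) auto
    have pos: "h (pres_class S R [(x, True)]) = f x"
      using h(2) x by (simp add: pres_gen_def pres_class_def)
    \<comment> \<open>Only positive letters have prescribed values, so negative ones are first
      recognised as inverses in the presented group.\<close>
    have "pres_class S R [(x, False)] = inv\<^bsub>presented_group S R\<^esub> pres_class S R [(x, True)]"
      by (rule h.inv_equality[symmetric])
         (use x gword_inv_cancel[of "[(x, True)]" S R] in \<open>simp_all add: presented_group_mult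
           presented_group_one pres_class_in_carrier pres_class_eq_iff gword_inv_def\<close>)
    then have neg: "h (pres_class S R [(x, False)]) = inv (f x)"
      using x pos by (simp add: pres_class_in_carrier)
    have "h (pres_class S R (l # u)) = h (pres_class S R [l]) \<otimes> h (pres_class S R u)"
      using Cons.prems presented_group_mult[of "[l]" S u R]
        h.hom_mult[of "pres_class S R [l]" "pres_class S R u"]
      by (simp add: pres_class_in_carrier)
    with Cons pos neg show ?case by (cases e) (auto simp: l)
  qed
  fix h h'
  assume h: "h \<in> extensional (carrier (presented_group S R)) \<and>
      group_hom (presented_group S R) G h \<and> (\<forall>x\<in>S. h (pres_gen S R x) = f x)"
    and h': "h' \<in> extensional (carrier (presented_group S R)) \<and>
      group_hom (presented_group S R) G h' \<and> (\<forall>x\<in>S. h' (pres_gen S R x) = f x)"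
  show "h = h'"
  proof (rule extensionalityI[of _ "carrier (presented_group S R)"])
    fix X assume "X \<in> carrier (presented_group S R)"
    then obtain u where "u \<in> gwords S" "X = pres_class S R u"
      by (rule carrier_presented_groupE)
    then show "h X = h' X"
      using h h' val[of h u] val[of h' u] by simp
  qed (use h h' in simp_all)
qed

end


section \<open>Arcs of the cycle and their rotations\<close>

section \<open>Cyclic intervals\<close>

text \<open>Subtraction of \<open>t\<close> modulo \<open>n\<close> with representatives
  \<open>1\<close> to \<open>n\<close>; it serves to move any arc to an initial segment.\<close>

definition rotate_down :: "nat \<Rightarrow> nat \<Rightarrow> nat \<Rightarrow> nat" where
  "rotate_down n t x = (if t < x then x - t else x + n - t)"

lemma cyclic_interval_subset: "cyclic_interval n I \<Longrightarrow> I \<subseteq> {1..n}"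
  by (auto simp: cyclic_interval_def)

lemma cyclic_intervalI1: "1 \<le> a \<Longrightarrow> a \<le> b \<Longrightarrow> b \<le> n \<Longrightarrow> I = {a..b} \<Longrightarrow> cyclic_interval n I"
  and cyclic_intervalI2:
    "1 \<le> a \<Longrightarrow> a \<le> b \<Longrightarrow> b \<le> n \<Longrightarrow> I = {b..n} \<union> {1..a} \<Longrightarrow> cyclic_interval n I"
  by (auto simp: cyclic_interval_def)

lemma rotate_down_in: "t < n \<Longrightarrow> x \<in> {1..n} \<Longrightarrow> rotate_down n t x \<in> {1..n}"
  by (auto simp: rotate_down_def)

lemma rotate_down_inverse:
  "t < n \<Longrightarrow> 0 < t \<Longrightarrow> x \<in> {1..n} \<Longrightarrow> rotate_down n (n - t) (rotate_down n t x) = x"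
  by (auto simp: rotate_down_def)

lemma rotate_down_0: "x \<in> {1..n} \<Longrightarrow> rotate_down n 0 x = x"
  by (auto simp: rotate_down_def)

lemma rotate_down_0_image:
  assumes "X \<subseteq> {1..n}"
  shows "rotate_down n 0 ` X = X"
proof -
  have "rotate_down n 0 ` X = (\<lambda>x. x) ` X"
    by (rule image_cong) (use assms rotate_down_0 in blast)+
  then show ?thesis by simp
qed

lemma inj_on_rotate_down: "t < n \<Longrightarrow> inj_on (rotate_down n t) {1..n}"
  by (auto simp: rotate_down_def inj_on_def split: if_splits)

lemma rotate_down_image_iff:
  assumes "0 < t" "t < n" "X \<subseteq> {1..n}"
  shows "y \<in> rotate_down n t ` X \<longleftrightarrow> y \<in> {1..n} \<and> rotate_down n (n - t) y \<in> X"
proof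
  assume "y \<in> rotate_down n t ` X"
  then obtain x where x: "x \<in> X" "y = rotate_down n t x" by blast
  then have "x \<in> {1..n}" using assms by blast
  then show "y \<in> {1..n} \<and> rotate_down n (n - t) y \<in> X"
    using x assms rotate_down_in[of t n x] rotate_down_inverse[of t n x] by simp
next
  assume y: "y \<in> {1..n} \<and> rotate_down n (n - t) y \<in> X"
  then have "rotate_down n t (rotate_down n (n - t) y) = y"
    using rotate_down_inverse[of "n - t" n y] assms by simp
  with y show "y \<in> rotate_down n t ` X" by (metis imageI)
qed

text \<open>Writing \<open>n = t + s\<close> makes the inverse rotation the one by \<open>s\<close>.
  The only subtraction left is guarded by its test, so interval claims become linear
  arithmetic.\<close>

lemma rotate_down_image_iff':
  assumes "0 < t" "0 < s" "X \<subseteq> {1..t + s}"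
  shows "x \<in> rotate_down (t + s) t ` X \<longleftrightarrow>
    1 \<le> x \<and> x \<le> t + s \<and> (if s < x then x - s else x + t) \<in> X"
  using assms by (subst rotate_down_image_iff) (auto simp: rotate_down_def)

lemma cyclic_interval_rotate_down_image:
  assumes t: "0 < t" "t < n" and X: "cyclic_interval n X"
  shows "cyclic_interval n (rotate_down n t ` X)"
proof -
  obtain s where n: "n = t + s" and s: "0 < s" using t by (metis less_imp_add_positive)
  note im = rotate_down_image_iff'[OF t(1) s cyclic_interval_subset[OF X[unfolded n]]]
  obtain a b where ab: "1 \<le> a" "a \<le> b" "b \<le> t + s"
    and X': "X = {a..b} \<or> X = {b..t + s} \<union> {1..a}"
    using X by (auto simp: cyclic_interval_def n)
  \<comment> \<open>Both endpoints move by the same amount unless the cut after \<open>t\<close>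
    separates them. In that case their order is reversed, and plain and wrapping shapes are
    exchanged.\<close>
  consider "b \<le> t" | "a \<le> t" "t < b" | "t < a" by linarith
  then have "cyclic_interval (t + s) (rotate_down (t + s) t ` X)"
  proof cases
    case 1
    from X' show ?thesis
    proof
      assume X': "X = {a..b}"
      show ?thesis
        by (rule cyclic_intervalI1[of "a + s" "b + s"]; (rule Set.set_eqI, subst im)?)
          (use ab t 1 X' in auto)
    next
      assume X': "X = {b..t + s} \<union> {1..a}"
      show ?thesis
        by (rule cyclic_intervalI2[of "a + s" "b + s"]; (rule Set.set_eqI, subst im)?)
          (use ab t 1 X' in auto)
    qed
  next
    case 2
    then obtain b' where b: "b = t + b'" "0 < b'" using less_imp_add_positive by blast
    from X' show ?thesis
    proof
      assume X': "X = {a..b}"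
      show ?thesis
        by (rule cyclic_intervalI2[of b' "a + s"]; (rule Set.set_eqI, subst im)?)
          (use ab t 2 b X' in auto)
    next
      assume X': "X = {b..t + s} \<union> {1..a}"
      show ?thesis
        by (rule cyclic_intervalI1[of b' "a + s"]; (rule Set.set_eqI, subst im)?)
          (use ab t 2 b X' in auto)
    qed
  next
    case 3
    then obtain a' where a: "a = t + a'" "0 < a'" using less_imp_add_positive by blast
    with ab obtain b' where b: "b = t + b'" by (metis add.assoc le_iff_add)
    from X' show ?thesis
    proof
      assume X': "X = {a..b}"
      show ?thesis
        by (rule cyclic_intervalI1[of a' b']; (rule Set.set_eqI, subst im)?)
          (use ab t a b X' in auto)
    next
      assume X': "X = {b..t + s} \<union> {1..a}"
      show ?thesis
        by (rule cyclic_intervalI2[of a' b']; (rule Set.set_eqI, subst im)?)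
          (use ab t a b X' in auto)
    qed
  qed
  then show ?thesis by (simp add: n)
qed

text \<open>Rotation by \<open>n - t\<close> undoes rotation by \<open>t\<close>, so preservation
  works both ways. For \<open>t = 0\<close> this amount would be \<open>n\<close>, hence the
  separate case.\<close>

lemma cyclic_interval_rotate_down_image_iff:
  assumes t: "t < n" and X: "X \<subseteq> {1..n}"
  shows "cyclic_interval n (rotate_down n t ` X) \<longleftrightarrow> cyclic_interval n X"
proof (cases "t = 0")
  case True
  with X show ?thesis by (simp add: rotate_down_0_image)
next
  case False
  have "rotate_down n (n - t) ` rotate_down n t ` X = X"
  proof -
    have "rotate_down n (n - t) ` rotate_down n t ` X = (\<lambda>x. x) ` X"
      unfolding image_image by (rule image_cong) (use X t False rotate_down_inverse in blast)+
    then show ?thesis by simp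
  qed
  then show ?thesis
    using cyclic_interval_rotate_down_image[of t n X] False t
      cyclic_interval_rotate_down_image[of "n - t" n "rotate_down n t ` X"] by auto
qed

lemma cyclic_interval_rotate_to_initial:
  assumes "cyclic_interval n I"
  obtains t where "t < n" "rotate_down n t ` I = {1..card I}"
proof -
  have "\<exists>t<n. \<exists>k. rotate_down n t ` I = {1..k}"
  proof -
    note sub = cyclic_interval_subset[OF assms]
    obtain a b where ab: "1 \<le> a" "a \<le> b" "b \<le> n" and I: "I = {a..b} \<or> I = {b..n} \<union> {1..a}"
      using assms by (auto simp: cyclic_interval_def)
    have id: "rotate_down n 0 ` I = I"
      using sub by (rule rotate_down_0_image)
    \<comment> \<open>A wrapping arc with \<open>a = b\<close> is the whole cycle. In the second and
      third cases \<open>t\<close> is one less than the element where the arc starts.\<close>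
    consider "I = {1..b}" | "I = {a..b}" "1 < a" | "I = {b..n} \<union> {1..a}" "a < b" | "I = {1..n}"
    proof -
      have "{a..n} \<union> {1..a} = {1..n}" using ab by auto
      with that ab I show thesis by (metis le_neq_implies_less)
    qed
    then show ?thesis
    proof cases
      case 1
      then show ?thesis using id ab by (intro exI[of _ 0]) auto
    next
      case 2
      obtain t s where ts: "a = Suc t" "n = t + s" "0 < t" "0 < s"
        using ab 2 less_imp_add_positive[of "a - 1" n] by (cases a) auto
      have "rotate_down n t ` I = {1..b - t}"
        unfolding ts by (rule Set.set_eqI, subst rotate_down_image_iff')
          (use ab 2 sub in \<open>auto simp: ts\<close>)
      then show ?thesis using ts by (intro exI[of _ t]) auto
    next
      case 3
      obtain t s where ts: "b = Suc t" "n = t + s" "0 < t" "0 < s"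
        using ab 3 less_imp_add_positive[of "b - 1" n] by (cases b) auto
      \<comment> \<open>Here \<open>s = n - b + 1\<close> is the length of the part up to
        \<open>n\<close>, and the \<open>a\<close> letters after the wrap follow it.\<close>
      have "rotate_down n t ` I = {1..s + a}"
        unfolding ts by (rule Set.set_eqI, subst rotate_down_image_iff')
          (use ab 3 sub in \<open>auto simp: ts\<close>)
      then show ?thesis using ts by (intro exI[of _ t]) auto
    next
      case 4
      then show ?thesis using id ab by (intro exI[of _ 0]) auto
    qed
  qed
  then obtain t k where t: "t < n" "rotate_down n t ` I = {1..k}" by blast
  have "card (rotate_down n t ` I) = card I"
    using inj_on_rotate_down[OF t(1)] cyclic_interval_subset[OF assms] card_image inj_on_subset by blast
  with t that show thesis by simp
qed

section \<open>Complements of arcs, and arcs extending an initial segment\<close>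

lemma cyclic_interval_complement:
  assumes "cyclic_interval n X" "X \<noteq> {1..n}"
  shows "cyclic_interval n ({1..n} - X)"
proof -
  obtain a b where ab: "1 \<le> a" "a \<le> b" "b \<le> n" and "X = {a..b} \<or> X = {b..n} \<union> {1..a}"
    using assms by (auto simp: cyclic_interval_def)
  \<comment> \<open>The complement of a plain interval wraps only if both \<open>1\<close> and
    \<open>n\<close> lie outside the interval.\<close>
  then consider "X = {a..b}" "a = 1" "b < n" | "X = {a..b}" "1 < a" "b = n"
    | "X = {a..b}" "1 < a" "b < n" | "X = {b..n} \<union> {1..a}"
    using assms(2) by fastforce
  then show ?thesis
  proof cases
    case 1
    show ?thesis by (rule cyclic_intervalI1[of "b + 1" n]) (use ab 1 in auto)
  next
    case 2
    show ?thesis by (rule cyclic_intervalI1[of 1 "a - 1"]) (use ab 2 in auto)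
  next
    case 3
    show ?thesis by (rule cyclic_intervalI2[of "a - 1" "b + 1"]) (use ab 3 in auto)
  next
    case 4
    have "a + 1 < b"
    proof (rule ccontr)
      assume "\<not> a + 1 < b"
      then have "X = {1..n}" using 4 ab by auto
      with assms show False by simp
    qed
    then show ?thesis by (intro cyclic_intervalI1[of "a + 1" "b - 1"]) (use ab 4 in auto)
  qed
qed

lemma cyclic_interval_complement_iff:
  assumes "X \<subseteq> {1..n}" "X \<noteq> {}" "X \<noteq> {1..n}"
  shows "cyclic_interval n ({1..n} - X) \<longleftrightarrow> cyclic_interval n X"
proof -
  have "{1..n} - ({1..n} - X) = X" "{1..n} - X \<noteq> {1..n}" using assms by auto
  then show ?thesis
    using cyclic_interval_complement[of n X] cyclic_interval_complement[of n "{1..n} - X"] assms by auto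
qed

text \<open>An arc and its complement are two blocks of the cycle, so membership cannot run in, out,
  in, out. This is the criterion used below to refute that a set is an arc.\<close>

lemma cyclic_interval_no_alternation:
  assumes "cyclic_interval n X" "i < j" "j < l" "l < m" "m \<le> n"
    "i \<in> X" "j \<notin> X" "l \<in> X"
  shows "m \<in> X"
  using assms by (auto simp: cyclic_interval_def)

text \<open>On the cycle, the segment from \<open>1\<close> to \<open>k\<close> can only grow at its
  right end, by \<open>k + 1\<close>, or at its left end, by \<open>n\<close>.\<close>

lemma cyclic_interval_insert_initial:
  assumes "1 \<le> k" "k < u" "u \<le> n"
  shows "cyclic_interval n (insert u {1..k}) \<longleftrightarrow> u = k + 1 \<or> u = n"
proof
  assume "cyclic_interval n (insert u {1..k})"
  from cyclic_interval_no_alternation[OF this, of 1 "k + 1" u n] assms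
  show "u = k + 1 \<or> u = n" by (cases "k + 1 < u"; cases "u < n") auto
next
  assume "u = k + 1 \<or> u = n"
  then show "cyclic_interval n (insert u {1..k})"
  proof
    assume "u = k + 1"
    then show ?thesis by (intro cyclic_intervalI1[of 1 u]) (use assms in auto)
  next
    assume "u = n"
    then show ?thesis by (intro cyclic_intervalI2[of k n]) (use assms in auto)
  qed
qed

text \<open>The three alternatives attach both letters on the right, one on each side, or both on
  the left.\<close>

lemma cyclic_interval_insert2_initial:
  assumes k: "1 \<le> k" "k < u" "k < v" "u \<le> n" "v \<le> n" "u \<noteq> v"
  shows "cyclic_interval n (insert u (insert v {1..k})) \<longleftrightarrow>
    {u, v} = {k + 1, k + 2} \<or> {u, v} = {k + 1, n} \<or> {u, v} = {n - 1, n}"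
proof -
  \<comment> \<open>The pair is sorted first; the unordered claim follows by symmetry.\<close>
  have *: "cyclic_interval n (insert u (insert v {1..k})) \<longleftrightarrow>
      (u = k + 1 \<and> v = k + 2) \<or> (u = k + 1 \<and> v = n) \<or> (u = n - 1 \<and> v = n)"
    if "k < u" "u < v" "v \<le> n" for u v
  proof
    assume C: "cyclic_interval n (insert u (insert v {1..k}))"
    note n = cyclic_interval_no_alternation[OF C]
    have "u = k + 1 \<or> v = n" using n[of 1 "k + 1" u n] that k(1) by (cases "k + 1 < u"; cases "u < n") auto
    moreover have "\<not> (k + 1 < u \<and> u < n - 1 \<and> v = n)" using n[of 1 "k + 1" u "n - 1"] that k(1) by auto
    moreover have "\<not> (u = k + 1 \<and> k + 2 < v \<and> v < n)" using n[of 1 "k + 2" v n] that k(1) by (cases "v < n") auto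
    ultimately show "(u = k + 1 \<and> v = k + 2) \<or> (u = k + 1 \<and> v = n) \<or> (u = n - 1 \<and> v = n)"
      using that k(1) by linarith
  next
    assume "(u = k + 1 \<and> v = k + 2) \<or> (u = k + 1 \<and> v = n) \<or> (u = n - 1 \<and> v = n)"
    then consider "u = k + 1" "v = k + 2" | "u = k + 1" "v = n" | "u = n - 1" "v = n" by blast
    then show "cyclic_interval n (insert u (insert v {1..k}))"
    proof cases
      case 1
      then show ?thesis by (intro cyclic_intervalI1[of 1 v]) (use that k(1) in auto)
    next
      case 2
      then show ?thesis by (intro cyclic_intervalI2[of u n]) (use that k(1) in auto)
    next
      case 3
      then show ?thesis by (intro cyclic_intervalI2[of k u]) (use that k(1) in auto)
    qed
  qed
  show ?thesis
  proof (cases "u < v")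
    case True
    with *[of u v] k show ?thesis by (auto simp: doubleton_eq_iff)
  next
    case False
    with *[of v u] k show ?thesis by (auto simp: doubleton_eq_iff insert_commute)
  qed
qed


text \<open>Hides the rotation formula: later arguments use only injectivity and invariance of
  arcs.\<close>

lemma cyclic_interval_normalize:
  assumes "cyclic_interval n I"
  obtains f where "inj_on f {1..n}" "f ` {1..n} \<subseteq> {1..n}" "f ` I = {1..card I}"
    "\<And>X. X \<subseteq> {1..n} \<Longrightarrow> cyclic_interval n (f ` X) \<longleftrightarrow> cyclic_interval n X"
proof -
  obtain t where t: "t < n" "rotate_down n t ` I = {1..card I}"
    using assms by (rule cyclic_interval_rotate_to_initial)
  show thesis
    by (rule that[OF inj_on_rotate_down[OF t(1)] _ t(2) cyclic_interval_rotate_down_image_iff[OF t(1)]])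
      (use t rotate_down_in in blast)
qed

text \<open>Every letter is attached at the right end (\<open>R\<close>) or the left end
  (\<open>L\<close>). In each case for \<open>x\<close> and \<open>y\<close>, a letter
  \<open>z\<close> at neither end would alternate with \<open>1\<close> and the free letters next to
  both ends.\<close>

lemma cyclic_interval_insert3_initial_cases:
  assumes k: "1 \<le> k" "k + 4 \<le> n"
    and xyz: "k < x" "k < y" "k < z" "x \<le> n" "y \<le> n" "z \<le> n" "x \<noteq> y" "x \<noteq> z" "y \<noteq> z"
    and x: "cyclic_interval n (insert x {1..k})"
    and xy: "cyclic_interval n (insert x (insert y {1..k}))"
    and C: "cyclic_interval n (insert x (insert y (insert z {1..k})))"
  shows "x = k + 1 \<and> y = k + 2 \<and> (z = k + 3 \<or> z = n) \<or>
    (x = k + 1 \<and> y = n \<or> x = n \<and> y = k + 1) \<and> (z = k + 2 \<or> z = n - 1) \<or>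
    x = n \<and> y = n - 1 \<and> (z = n - 2 \<or> z = k + 1)"
proof -
  note na = cyclic_interval_no_alternation[OF C]
  have "x = k + 1 \<or> x = n"
    using x k xyz cyclic_interval_insert_initial by blast
  moreover have "{x, y} = {k + 1, k + 2} \<or> {x, y} = {k + 1, n} \<or> {x, y} = {n - 1, n}"
    using xy k xyz cyclic_interval_insert2_initial[of k x y n] by blast
  ultimately consider "x = k + 1" "y = k + 2" | "x = k + 1" "y = n" | "x = n" "y = k + 1"
    | "x = n" "y = n - 1"
    using k unfolding doubleton_eq_iff by linarith
  then show ?thesis
  proof cases
    case 1
    have "z = k + 3 \<or> z = n"
    proof (rule ccontr)
      assume "\<not> ?thesis"
      then have z: "k + 3 < z" "z < n" using 1 k xyz by linarith+
      have "n \<in> insert x (insert y (insert z {1..k}))"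
        by (rule na[of 1 "k + 3" z]) (use 1 k z in simp_all)
      then show False using 1 k z by simp
    qed
    with 1 show ?thesis by blast
  next
    case 2
    have "z = k + 2 \<or> z = n - 1"
    proof (rule ccontr)
      assume "\<not> ?thesis"
      then have z: "k + 2 < z" "z < n - 1" using 2 k xyz by linarith+
      have "n - 1 \<in> insert x (insert y (insert z {1..k}))"
        by (rule na[of 1 "k + 2" z]) (use 2 k z in simp_all)
      then show False using 2 k z by simp
    qed
    with 2 show ?thesis by blast
  next
    case 3
    have "z = k + 2 \<or> z = n - 1"
    proof (rule ccontr)
      assume "\<not> ?thesis"
      then have z: "k + 2 < z" "z < n - 1" using 3 k xyz by linarith+
      have "n - 1 \<in> insert x (insert y (insert z {1..k}))"
        by (rule na[of 1 "k + 2" z]) (use 3 k z in simp_all)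
      then show False using 3 k z by simp
    qed
    with 3 show ?thesis by blast
  next
    case 4
    have "z = k + 1 \<or> z = n - 2"
    proof (rule ccontr)
      assume "\<not> ?thesis"
      then have z: "k + 1 < z" "z < n - 2" using 4 k xyz by linarith+
      have "n - 2 \<in> insert x (insert y (insert z {1..k}))"
        by (rule na[of 1 "k + 1" z]) (use 4 k z in simp_all)
      then show False using 4 k z by auto
    qed
    with 4 show ?thesis by blast
  qed
qed

text \<open>The four tuples belong, in this order, to the words \<open>RRR\<close>,
  \<open>RRL\<close>, \<open>RLR\<close> and \<open>RLL\<close>, up to exchange of \<open>L\<close>
  and \<open>R\<close>.\<close>

lemma cyclic_interval_extensions_initial:
  assumes k: "1 \<le> k" "k + 4 \<le> n"
    and xyz: "k < x" "k < y" "k < z" "x \<le> n" "y \<le> n" "z \<le> n" "x \<noteq> y" "x \<noteq> z" "y \<noteq> z"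
    and C: "cyclic_interval n (insert x {1..k})"
      "cyclic_interval n (insert x (insert y {1..k}))"
      "cyclic_interval n (insert x (insert y (insert z {1..k})))"
  defines "S \<equiv> \<lambda>u. cyclic_interval n (insert u {1..k})"
    and "P \<equiv> \<lambda>u v. cyclic_interval n (insert u (insert v {1..k}))"
  shows "(S y, S z, P y z, P x z) \<in> {(False, False, False, False), (False, True, False, True),
    (True, False, False, True), (True, False, True, False)}"
proof -
  have S: "S u \<longleftrightarrow> u = k + 1 \<or> u = n" if "u \<in> {x, y, z}" for u
    unfolding S_def using that k xyz by (intro cyclic_interval_insert_initial) auto
  have P: "P u v \<longleftrightarrow> {u, v} = {k + 1, k + 2} \<or> {u, v} = {k + 1, n} \<or> {u, v} = {n - 1, n}"
    if "u \<in> {x, y, z}" "v \<in> {x, y, z}" "u \<noteq> v" for u v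
    unfolding P_def using that k xyz by (intro cyclic_interval_insert2_initial) auto
  have Sy: "S y \<longleftrightarrow> y = k + 1 \<or> y = n" by (rule S) simp
  have Sz: "S z \<longleftrightarrow> z = k + 1 \<or> z = n" by (rule S) simp
  have Pyz: "P y z \<longleftrightarrow> {y, z} = {k + 1, k + 2} \<or> {y, z} = {k + 1, n} \<or> {y, z} = {n - 1, n}"
    by (rule P) (use xyz in simp_all)
  have Pxz: "P x z \<longleftrightarrow> {x, z} = {k + 1, k + 2} \<or> {x, z} = {k + 1, n} \<or> {x, z} = {n - 1, n}"
    by (rule P) (use xyz in simp_all)
  \<comment> \<open>Replacing \<open>n\<close> by a sum lets simplification decide all equalities
    between letters near the two ends.\<close>
  obtain d where n: "n = k + 4 + d" using k(2) le_Suc_ex by blast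
  note cases = cyclic_interval_insert3_initial_cases[OF k xyz C]
  show ?thesis
    unfolding Sy Sz Pyz Pxz doubleton_eq_iff
    using cases by (elim disjE conjE) (simp_all add: n)
qed

text \<open>A rotation taking \<open>I\<close> to an initial segment preserves and reflects every
  condition involved, which reduces the claim to that segment.\<close>

lemma cyclic_interval_extensions:
  assumes I: "cyclic_interval n I" "card I + 4 \<le> n"
    and xyz: "x \<in> {1..n} - I" "y \<in> {1..n} - I" "z \<in> {1..n} - I" "x \<noteq> y" "x \<noteq> z" "y \<noteq> z"
    and C: "cyclic_interval n (insert x I)"
      "cyclic_interval n (insert x (insert y I))"
      "cyclic_interval n (insert x (insert y (insert z I)))"
  defines "S \<equiv> \<lambda>u. cyclic_interval n (insert u I)"
    and "P \<equiv> \<lambda>u v. cyclic_interval n (insert u (insert v I))"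
  shows "(S y, S z, P y z, P x z) \<in> {(False, False, False, False), (False, True, False, True),
    (True, False, False, True), (True, False, True, False)}"
proof -
  obtain f where f: "inj_on f {1..n}" "f ` {1..n} \<subseteq> {1..n}" "f ` I = {1..card I}"
      "\<And>X. X \<subseteq> {1..n} \<Longrightarrow> cyclic_interval n (f ` X) \<longleftrightarrow> cyclic_interval n X"
    using cyclic_interval_normalize[OF I(1)] by metis
  have sub: "I \<subseteq> {1..n}" and "I \<noteq> {}"
    using I cyclic_interval_subset by (auto simp: cyclic_interval_def)
  then have "finite I" "1 \<le> card I"
    using finite_subset card_gt_0_iff[of I] by (auto simp: Suc_le_eq)
  have f_new: "card I < f u \<and> f u \<le> n" if u: "u \<in> {1..n} - I" for u
  proof -
    have "f u \<notin> f ` I" using u sub f(1) by (metis Diff_iff inj_on_image_mem_iff)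
    moreover have "f u \<in> {1..n}" using f(2) u by blast
    ultimately show ?thesis using f(3) by auto
  qed
  have S: "cyclic_interval n (insert (f u) {1..card I}) \<longleftrightarrow> S u" if "u \<in> {1..n}" for u
    using f(4)[of "insert u I"] that sub by (simp add: S_def f(3))
  have P: "cyclic_interval n (insert (f u) (insert (f v) {1..card I})) \<longleftrightarrow> P u v"
    if "u \<in> {1..n}" "v \<in> {1..n}" for u v
    using f(4)[of "insert u (insert v I)"] that sub by (simp add: P_def f(3))
  have C3: "cyclic_interval n (insert (f x) (insert (f y) (insert (f z) {1..card I})))"
    using f(4)[of "insert x (insert y (insert z I))"] xyz sub C(3) by (simp add: f(3))
  have neq: "f x \<noteq> f y" "f x \<noteq> f z" "f y \<noteq> f z"
    using xyz f(1) by (auto dest: inj_onD)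
  have mem: "x \<in> {1..n}" "y \<in> {1..n}" "z \<in> {1..n}" using xyz by blast+
  have "S x" "P x y" using C by (simp_all add: S_def P_def)
  then have C12: "cyclic_interval n (insert (f x) {1..card I})"
      "cyclic_interval n (insert (f x) (insert (f y) {1..card I}))"
    using S[OF mem(1)] P[OF mem(1,2)] by blast+
  note lt = f_new[OF xyz(1)] f_new[OF xyz(2)] f_new[OF xyz(3)]
  show ?thesis
    using cyclic_interval_extensions_initial[OF \<open>1 \<le> card I\<close> I(2) _ _ _ _ _ _ neq C12 C3] lt
    unfolding S[OF mem(2)] S[OF mem(3)] P[OF mem(2,3)] P[OF mem(1,3)] by blast
qed

text \<open>After rotation the triple is \<open>{1, 2, 3}\<close>, and a pair fails to be an arc
  exactly when it omits the middle letter \<open>2\<close>. So exactly one pair fails, and it is not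
  \<open>{x, y}\<close>.\<close>

lemma cyclic_interval_triple_pairs:
  assumes n: "4 \<le> n" and K: "cyclic_interval n {x, y, z}" "x \<noteq> y" "x \<noteq> z" "y \<noteq> z"
    and xy: "cyclic_interval n {x, y}"
  shows "cyclic_interval n {y, z} \<longleftrightarrow> \<not> cyclic_interval n {x, z}"
proof -
  have card: "card {x, y, z} = 3" using K by simp
  obtain f where f: "inj_on f {1..n}" "f ` {x, y, z} = {1..3}"
      "\<And>X. X \<subseteq> {1..n} \<Longrightarrow> cyclic_interval n (f ` X) \<longleftrightarrow> cyclic_interval n X"
    using cyclic_interval_normalize[OF K(1), unfolded card] by metis
  have "{1..3} = {1, 2, 3 :: nat}" by auto
  then have f123: "{f x, f y, f z} = {1, 2, 3}" using f(2) by simp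
  have sub: "{x, y, z} \<subseteq> {1..n}" using cyclic_interval_subset K by blast
  then have neq: "f x \<noteq> f y" "f x \<noteq> f z" "f y \<noteq> f z"
    using K f(1) by (auto dest: inj_onD)
  have f2: "cyclic_interval n {f u, f v} \<longleftrightarrow> cyclic_interval n {u, v}"
    if "{u, v} \<subseteq> {x, y, z}" for u v
    using f(3)[of "{u, v}"] sub that by auto
  have 12: "cyclic_interval n {1, 2}"
    by (rule cyclic_intervalI1[of 1 2]) (use n in auto)
  have 23: "cyclic_interval n {2, 3}"
    by (rule cyclic_intervalI1[of 2 3]) (use n in auto)
  \<comment> \<open>The letter \<open>4\<close> must exist: for \<open>n = 3\<close> the pair
    \<open>{1, 3}\<close> would be a wrapping arc.\<close>
  have 13: "\<not> cyclic_interval n {1, 3}"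
    using cyclic_interval_no_alternation[of n "{1, 3}" 1 2 3 4] n by auto
  have pair: "cyclic_interval n ({1, 2, 3} - {w}) \<longleftrightarrow> w \<noteq> 2" if "w \<in> {1, 2, 3}" for w
  proof -
    have "{1, 2, 3} - {1} = {2, 3 :: nat}" "{1, 2, 3} - {2} = {1, 3 :: nat}"
      "{1, 2, 3} - {3} = {1, 2 :: nat}" by auto
    then show ?thesis using that 12 23 13 by (elim insertE) simp_all
  qed
  have sets: "{f x, f y} = {1, 2, 3} - {f z}" "{f y, f z} = {1, 2, 3} - {f x}"
    "{f x, f z} = {1, 2, 3} - {f y}"
    unfolding f123[symmetric] using neq by auto
  have mem: "f x \<in> {1, 2, 3}" "f y \<in> {1, 2, 3}" "f z \<in> {1, 2, 3}"
    unfolding f123[symmetric] by simp_all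
  have "cyclic_interval n {x, y} \<longleftrightarrow> f z \<noteq> 2" "cyclic_interval n {y, z} \<longleftrightarrow> f x \<noteq> 2"
    "cyclic_interval n {x, z} \<longleftrightarrow> f y \<noteq> 2"
    using f2[of x y] f2[of y z] f2[of x z] sets pair[OF mem(1)] pair[OF mem(2)] pair[OF mem(3)]
    by simp_all
  moreover have "2 \<in> {f x, f y, f z}" unfolding f123 by simp
  ultimately show ?thesis using xy neq by auto
qed


section \<open>Adjacent exchanges and their effect on prefix sets\<close>

section \<open>The maps on arc permutations\<close>

lemma arc_permutations_prefix:
  "\<pi> \<in> arc_permutations n \<Longrightarrow> 1 \<le> j \<Longrightarrow> j \<le> n \<Longrightarrow> cyclic_interval n (\<pi> ` {1..j})"
  by (simp add: arc_permutations_def)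

lemma arc_permutations_permutes: "\<pi> \<in> arc_permutations n \<Longrightarrow> \<pi> permutes {1..n}"
  by (simp add: arc_permutations_def)

lemma transpose_image_initial:
  fixes i j :: nat
  shows "transpose (i + 1) (i + 2) ` {1..j} = (if j = i + 1 then insert (i + 2) {1..i} else {1..j})"
proof -
  have "transpose (i + 1) (i + 2) x = x" if "x \<in> {1..i}" for x
    using that by (simp add: transpose_def)
  then have id: "transpose (i + 1) (i + 2) ` X = X" if "X \<subseteq> {1..i}" for X
    using image_cong[of X X "transpose (i + 1) (i + 2)" "\<lambda>x. x"] that by (metis image_ident subsetD)
  consider "j \<le> i" | "j = i + 1" | "i + 2 \<le> j" by linarith
  then show ?thesis
  proof cases
    case 1
    then have "transpose (i + 1) (i + 2) ` {1..j} = {1..j}" by (intro id) simp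
    with 1 show ?thesis by simp
  next
    case 2
    have "{1..j} = insert (i + 1) {1..i}" using 2 by auto
    then show ?thesis
      using 2 id[of "{1..i}"] by simp
  next
    case 3
    then have "transpose (i + 1) (i + 2) permutes {1..j}"
      by (intro permutes_swap_id) simp_all
    with 3 show ?thesis by (simp add: permutes_image)
  qed
qed

text \<open>The exchange changes only the prefix set of length \<open>i + 1\<close>, so one interval
  condition remains to be tested.\<close>

lemma comp_transpose_mem_arc_permutations_iff:
  assumes \<pi>: "\<pi> \<in> arc_permutations n" and i: "i + 2 \<le> n"
  shows "\<pi> \<circ> transpose (i + 1) (i + 2) \<in> arc_permutations n \<longleftrightarrow>
    cyclic_interval n (insert (\<pi> (i + 2)) (\<pi> ` {1..i}))"
proof -
  have "\<pi> \<circ> transpose (i + 1) (i + 2) permutes {1..n}"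
    using i by (intro permutes_compose[OF permutes_swap_id] arc_permutations_permutes[OF \<pi>]) simp_all
  moreover have "(\<pi> \<circ> transpose (i + 1) (i + 2)) ` {1..j} =
      (if j = i + 1 then insert (\<pi> (i + 2)) (\<pi> ` {1..i}) else \<pi> ` {1..j})" for j
    by (simp only: image_comp[symmetric] transpose_image_initial image_insert split: if_split) simp
  ultimately show ?thesis
    using arc_permutations_prefix[OF \<pi>] i by (auto simp: arc_permutations_def)
qed

lemma rho_mem: "\<pi> \<in> arc_permutations n \<Longrightarrow> rho n i \<pi> \<in> arc_permutations n"
  by (simp add: rho_def Let_def)

lemma rho_rho: "\<pi> \<in> arc_permutations n \<Longrightarrow> rho n i (rho n i \<pi>) = \<pi>"
  by (simp add: rho_def Let_def comp_assoc)

lemma rho_eq: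
  assumes "\<pi> \<in> arc_permutations n" "i + 2 \<le> n"
  shows "rho n i \<pi> = (if cyclic_interval n (insert (\<pi> (i + 2)) (\<pi> ` {1..i}))
    then \<pi> \<circ> transpose (i + 1) (i + 2) else \<pi>)"
  using comp_transpose_mem_arc_permutations_iff[OF assms] by (simp add: rho_def)

text \<open>Neither exchange affects the test of the other: the one at \<open>j\<close> happens
  beyond position \<open>i + 2\<close>, and the one at \<open>i\<close> stays within the first
  \<open>j\<close> letters and preserves their set.\<close>

lemma rho_commute:
  assumes \<pi>: "\<pi> \<in> arc_permutations n" and ij: "i + 2 \<le> j" "j + 2 \<le> n"
  shows "rho n i (rho n j \<pi>) = rho n j (rho n i \<pi>)"
proof -
  let ?s = "transpose (i + 1) (i + 2)" and ?t = "transpose (j + 1) (j + 2)"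
  have i: "i + 2 \<le> n" using ij by simp
  have "\<pi> \<circ> ?t \<circ> ?s = \<pi> \<circ> ?s \<circ> ?t"
    using ij by (auto simp: fun_eq_iff transpose_def)
  moreover have "(\<pi> \<circ> ?t) (i + 2) = \<pi> (i + 2)" "(\<pi> \<circ> ?s) (j + 2) = \<pi> (j + 2)"
    using ij by (simp_all add: transpose_def)
  moreover have "(\<pi> \<circ> ?t) ` {1..i} = \<pi> ` {1..i}" "(\<pi> \<circ> ?s) ` {1..j} = \<pi> ` {1..j}"
    unfolding image_comp[symmetric] transpose_image_initial using ij by simp_all
  ultimately show ?thesis
    using rho_mem[OF \<pi>, of i] rho_mem[OF \<pi>, of j]
      rho_eq[OF \<pi> i] rho_eq[OF \<pi> ij(2)]
      rho_eq[OF rho_mem[OF \<pi>, of j] i] rho_eq[OF rho_mem[OF \<pi>, of i] ij(2)]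
    by (simp split: if_splits)
qed

section \<open>Two neighbouring maps acting on three consecutive letters\<close>

definition word_update :: "(nat \<Rightarrow> nat) \<Rightarrow> nat \<Rightarrow> nat \<Rightarrow> nat \<Rightarrow> nat \<Rightarrow> nat \<Rightarrow> nat" where
  "word_update \<pi> i u v w = \<pi>(i + 1 := u, i + 2 := v, i + 3 := w)"

lemma word_update_self: "word_update \<pi> i (\<pi> (i + 1)) (\<pi> (i + 2)) (\<pi> (i + 3)) = \<pi>"
  by (simp add: word_update_def)

lemma word_update_comp_transpose:
  "word_update \<pi> i u v w \<circ> transpose (i + 1) (i + 2) = word_update \<pi> i v u w"
  "word_update \<pi> i u v w \<circ> transpose (i + 2) (i + 3) = word_update \<pi> i u w v"
  by (auto simp: fun_eq_iff word_update_def transpose_def)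

lemma rho_word_update:
  "rho n i (word_update \<pi> i u v w) =
    (if word_update \<pi> i v u w \<in> arc_permutations n
     then word_update \<pi> i v u w else word_update \<pi> i u v w)"
  "rho n (i + 1) (word_update \<pi> i u v w) =
    (if word_update \<pi> i u w v \<in> arc_permutations n
     then word_update \<pi> i u w v else word_update \<pi> i u v w)"
  using word_update_comp_transpose[of \<pi> i u v w] by (simp_all add: rho_def numeral_3_eq_3)

lemma word_update_permutes:
  assumes "word_update \<pi> i u v w permutes S" "i + 1 \<in> S" "i + 2 \<in> S" "i + 3 \<in> S"
  shows "word_update \<pi> i v u w permutes S" "word_update \<pi> i u w v permutes S"
  unfolding word_update_comp_transpose[of \<pi> i u v w, symmetric]
  by (rule permutes_compose[OF permutes_swap_id assms(1)]; rule assms)+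

text \<open>Rearranging three consecutive letters can change only the prefix sets of lengths
  \<open>i + 1\<close> and \<open>i + 2\<close>; the other conditions are inherited from
  \<open>\<pi>\<close>.\<close>

lemma word_update_mem_arc_permutations_iff:
  assumes \<pi>: "\<pi> \<in> arc_permutations n" and i: "i + 3 \<le> n"
    and xyz: "x = \<pi> (i + 1)" "y = \<pi> (i + 2)" "z = \<pi> (i + 3)"
    and uvw: "(u, v, w) \<in> {(x, y, z), (x, z, y), (y, x, z), (y, z, x), (z, x, y), (z, y, x)}"
  shows "word_update \<pi> i u v w \<in> arc_permutations n \<longleftrightarrow>
    cyclic_interval n (insert u (\<pi> ` {1..i})) \<and>
    cyclic_interval n (insert u (insert v (\<pi> ` {1..i})))"
proof -
  let ?q = "word_update \<pi> i u v w"
  have "word_update \<pi> i x y z permutes {1..n}"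
    using arc_permutations_permutes[OF \<pi>] word_update_self by (simp add: xyz)
  moreover have "i + 1 \<in> {1..n}" "i + 2 \<in> {1..n}" "i + 3 \<in> {1..n}"
    using i by auto
  note p = word_update_permutes[OF _ this]
  \<comment> \<open>All six arrangements arise from \<open>x y z\<close> by repeated adjacent
    exchanges.\<close>
  ultimately have perm: "?q permutes {1..n}"
    using uvw p by blast
  have initial: "?q ` {1..j} = \<pi> ` {1..j}" if "j \<le> i" for j
    using that by (intro image_cong) (auto simp: word_update_def)
  have q: "?q (i + 1) = u" "?q (i + 2) = v" "?q (i + 3) = w"
    by (simp_all add: word_update_def)
  have init1: "{1..i + 1} = insert (i + 1) {1..i}"
    and init2: "{1..i + 2} = insert (i + 1) (insert (i + 2) {1..i})" by auto
  have 1: "?q ` {1..i + 1} = insert u (\<pi> ` {1..i})"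
    unfolding init1 image_insert q initial[OF order_refl] ..
  have 2: "?q ` {1..i + 2} = insert u (insert v (\<pi> ` {1..i}))"
    unfolding init2 image_insert q initial[OF order_refl] ..
  have final: "?q ` {1..j} = \<pi> ` {1..j}" if "i + 3 \<le> j" for j
  proof -
    have split: "{1..j} = {1..i} \<union> {i + 1, i + 2, i + 3} \<union> {i + 4..j}" using that by auto
    have "?q ` {i + 4..j} = \<pi> ` {i + 4..j}"
      by (intro image_cong) (auto simp: word_update_def)
    moreover have "?q ` {i + 1, i + 2, i + 3} = {u, v, w}"
      unfolding image_insert image_empty q ..
    moreover have "{u, v, w} = \<pi> ` {i + 1, i + 2, i + 3}" using uvw by (auto simp: xyz)
    ultimately show ?thesis unfolding split image_Un using initial[of i] by simp
  qed
  have rest: "cyclic_interval n (?q ` {1..j})"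
    if "j \<in> {1..n}" "j \<noteq> i + 1" "j \<noteq> i + 2" for j
  proof -
    have "j \<le> i \<or> i + 3 \<le> j" using that by auto
    then have "?q ` {1..j} = \<pi> ` {1..j}" using initial final by blast
    with that arc_permutations_prefix[OF \<pi>, of j] show ?thesis by simp
  qed
  have "i + 1 \<in> {1..n}" "i + 2 \<in> {1..n}" using i by auto
  then have "(\<forall>j\<in>{1..n}. cyclic_interval n (?q ` {1..j})) \<longleftrightarrow>
      cyclic_interval n (?q ` {1..i + 1}) \<and> cyclic_interval n (?q ` {1..i + 2})"
    using rest by blast
  then show ?thesis
    unfolding 1 2 using perm by (simp add: arc_permutations_def)
qed


text \<open>Collects the facts in the form in which the results on extending arcs expect
  them.\<close>

lemma arc_permutation_letters:
  assumes \<pi>: "\<pi> \<in> arc_permutations n" and i: "i + 3 \<le> n"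
    and xyz: "x = \<pi> (i + 1)" "y = \<pi> (i + 2)" "z = \<pi> (i + 3)"
  shows "card (\<pi> ` {1..i}) = i"
    and "x \<in> {1..n} - \<pi> ` {1..i}" "y \<in> {1..n} - \<pi> ` {1..i}" "z \<in> {1..n} - \<pi> ` {1..i}"
    and "x \<noteq> y" "x \<noteq> z" "y \<noteq> z"
    and "cyclic_interval n (insert x (\<pi> ` {1..i}))"
      "cyclic_interval n (insert x (insert y (\<pi> ` {1..i})))"
      "cyclic_interval n (insert x (insert y (insert z (\<pi> ` {1..i}))))"
proof -
  have p: "\<pi> permutes {1..n}" by (rule arc_permutations_permutes[OF \<pi>])
  then have inj: "inj \<pi>" by (rule permutes_inj)
  show "card (\<pi> ` {1..i}) = i"
    using card_image[OF inj_on_subset[OF inj subset_UNIV], of "{1..i}"] by simp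
  have "\<pi> j \<in> {1..n} - \<pi> ` {1..i}" if "i < j" "j \<le> n" for j
    using permutes_in_image[OF p, of j] that by (simp add: inj_image_mem_iff[OF inj])
  from this[of "i + 1"] this[of "i + 2"] this[of "i + 3"] i
  show "x \<in> {1..n} - \<pi> ` {1..i}" "y \<in> {1..n} - \<pi> ` {1..i}" "z \<in> {1..n} - \<pi> ` {1..i}"
    unfolding xyz by simp_all
  show "x \<noteq> y" "x \<noteq> z" "y \<noteq> z"
    unfolding xyz inj_eq[OF inj] by simp_all
  have init: "{1..i + 1} = insert (i + 1) {1..i}"
    "{1..i + 2} = insert (i + 1) (insert (i + 2) {1..i})"
    "{1..i + 3} = insert (i + 1) (insert (i + 2) (insert (i + 3) {1..i}))" by auto
  have "cyclic_interval n (\<pi> ` {1..i + 1})" "cyclic_interval n (\<pi> ` {1..i + 2})"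
    "cyclic_interval n (\<pi> ` {1..i + 3})"
    using i by (intro arc_permutations_prefix[OF \<pi>]; simp)+
  then show "cyclic_interval n (insert x (\<pi> ` {1..i}))"
      "cyclic_interval n (insert x (insert y (\<pi> ` {1..i})))"
      "cyclic_interval n (insert x (insert y (insert z (\<pi> ` {1..i}))))"
    unfolding init image_insert xyz .
qed

text \<open>Exchanging the first two of the three letters keeps an arc permutation if the new first
  letter satisfies \<open>S\<close>; exchanging the last two, if the new first two satisfy \<open>P\<close>. So each of
  the tuples of truth values makes the orbit of \<open>\<pi>\<close> a path, with one or three vertices in the
  first lemma and with four in the second.\<close>

lemma rho_rho_funpow_3:
  assumes \<pi>: "\<pi> \<in> arc_permutations n" and i: "i + 3 \<le> n"
    and xyz: "x = \<pi> (i + 1)" "y = \<pi> (i + 2)" "z = \<pi> (i + 3)"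
  defines "S \<equiv> \<lambda>u. cyclic_interval n (insert u (\<pi> ` {1..i}))"
    and "P \<equiv> \<lambda>u v. cyclic_interval n (insert u (insert v (\<pi> ` {1..i})))"
  assumes cases: "(S y, S z, P y z, P x z) \<in> {(False, False, False, False),
    (False, True, False, True), (True, False, False, True), (True, False, True, False)}"
  shows "((rho n i \<circ> rho n (i + 1)) ^^ 3) \<pi> = \<pi>"
proof -
  define q where "q = word_update \<pi> i"
  define A where "A = arc_permutations n"
  define f g where "f = rho n i" and "g = rho n (i + 1)"
  note l = arc_permutation_letters[OF \<pi> i xyz]
  have "q u v w \<in> A \<longleftrightarrow> S u \<and> P u v"
    if "(u, v, w) \<in> {(x, y, z), (x, z, y), (y, x, z), (y, z, x), (z, x, y), (z, y, x)}" for u v w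
    unfolding q_def A_def S_def P_def
    by (rule word_update_mem_arc_permutations_iff[OF \<pi> i xyz that])
  moreover have "S x" "P x y" using l(8,9) by (simp_all add: S_def P_def)
  moreover have "P y x = P x y" "P z x = P x z" "P z y = P y z"
    by (simp_all add: P_def insert_commute)
  \<comment> \<open>Since \<open>S x\<close> and \<open>P x y\<close> hold and \<open>P\<close> is
    symmetric, four truth values decide membership for all six arrangements.\<close>
  ultimately have mem: "q x y z \<in> A" "q x z y \<in> A \<longleftrightarrow> P x z" "q y x z \<in> A \<longleftrightarrow> S y"
      "q y z x \<in> A \<longleftrightarrow> S y \<and> P y z" "q z x y \<in> A \<longleftrightarrow> S z \<and> P x z"
      "q z y x \<in> A \<longleftrightarrow> S z \<and> P y z"
    by simp_all
  have f: "f (q u v w) = (if q v u w \<in> A then q v u w else q u v w)"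
    and g: "g (q u v w) = (if q u w v \<in> A then q u w v else q u v w)" for u v w
    unfolding f_def g_def q_def A_def by (rule rho_word_update)+
  have "((f \<circ> g) ^^ 3) (q x y z) = q x y z"
    using cases by (elim insertE emptyE) (simp_all add: eval_nat_numeral f g mem)
  moreover have "q x y z = \<pi>" by (simp only: q_def xyz word_update_self)
  ultimately show ?thesis by (simp add: f_def g_def)
qed

lemma rho_rho_funpow_4:
  assumes \<pi>: "\<pi> \<in> arc_permutations n" and i: "i + 3 \<le> n"
    and xyz: "x = \<pi> (i + 1)" "y = \<pi> (i + 2)" "z = \<pi> (i + 3)"
  defines "S \<equiv> \<lambda>u. cyclic_interval n (insert u (\<pi> ` {1..i}))"
    and "P \<equiv> \<lambda>u v. cyclic_interval n (insert u (insert v (\<pi> ` {1..i})))"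
  assumes cases: "(S y, S z, P y z, P x z) \<in> {(True, True, True, False),
    (True, True, False, True), (True, False, True, True), (False, True, True, True)}"
  shows "((rho n i \<circ> rho n (i + 1)) ^^ 4) \<pi> = \<pi>"
proof -
  define q where "q = word_update \<pi> i"
  define A where "A = arc_permutations n"
  define f g where "f = rho n i" and "g = rho n (i + 1)"
  note l = arc_permutation_letters[OF \<pi> i xyz]
  have "q u v w \<in> A \<longleftrightarrow> S u \<and> P u v"
    if "(u, v, w) \<in> {(x, y, z), (x, z, y), (y, x, z), (y, z, x), (z, x, y), (z, y, x)}" for u v w
    unfolding q_def A_def S_def P_def
    by (rule word_update_mem_arc_permutations_iff[OF \<pi> i xyz that])
  moreover have "S x" "P x y" using l(8,9) by (simp_all add: S_def P_def)
  moreover have "P y x = P x y" "P z x = P x z" "P z y = P y z"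
    by (simp_all add: P_def insert_commute)
  ultimately have mem: "q x y z \<in> A" "q x z y \<in> A \<longleftrightarrow> P x z" "q y x z \<in> A \<longleftrightarrow> S y"
      "q y z x \<in> A \<longleftrightarrow> S y \<and> P y z" "q z x y \<in> A \<longleftrightarrow> S z \<and> P x z"
      "q z y x \<in> A \<longleftrightarrow> S z \<and> P y z"
    by simp_all
  have f: "f (q u v w) = (if q v u w \<in> A then q v u w else q u v w)"
    and g: "g (q u v w) = (if q u w v \<in> A then q u w v else q u v w)" for u v w
    unfolding f_def g_def q_def A_def by (rule rho_word_update)+
  have "((f \<circ> g) ^^ 4) (q x y z) = q x y z"
    using cases by (elim insertE emptyE) (simp_all add: eval_nat_numeral f g mem)
  moreover have "q x y z = \<pi>" by (simp only: q_def xyz word_update_self)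
  ultimately show ?thesis by (simp add: f_def g_def)
qed

text \<open>The prefix of length \<open>i\<close> is nonempty and misses at least four letters, so
  its two ends stay apart and the \<open>L\<close> and \<open>R\<close> analysis applies.\<close>

lemma rho_braid_inner:
  assumes \<pi>: "\<pi> \<in> arc_permutations n" and i: "1 \<le> i" "i + 4 \<le> n"
  shows "((rho n i \<circ> rho n (i + 1)) ^^ 3) \<pi> = \<pi>"
proof -
  have i3: "i + 3 \<le> n" using i by simp
  note l = arc_permutation_letters[OF \<pi> i3 HOL.refl HOL.refl HOL.refl]
  have "cyclic_interval n (\<pi> ` {1..i})"
    using i by (intro arc_permutations_prefix[OF \<pi>]) simp_all
  moreover have "card (\<pi> ` {1..i}) + 4 \<le> n" using i l(1) by simp
  ultimately show ?thesis
    by (rule rho_rho_funpow_3[OF \<pi> i3 HOL.refl HOL.refl HOL.refl cyclic_interval_extensions[OF _ _ l(2-)]])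
qed

lemma cyclic_interval_singleton: "x \<in> {1..n} \<Longrightarrow> cyclic_interval n {x}"
  by (rule cyclic_intervalI1[of x x]) auto

text \<open>With an empty prefix, \<open>S\<close> holds for all three letters because singletons
  are arcs. Exactly one of the two remaining pairs is an arc, which gives one of the first two
  tuples for order 4.\<close>

lemma rho_braid_first:
  assumes \<pi>: "\<pi> \<in> arc_permutations n" and n: "4 \<le> n"
  shows "((rho n 0 \<circ> rho n (0 + 1)) ^^ 4) \<pi> = \<pi>"
proof -
  have i: "0 + 3 \<le> n" using n by simp
  define x y z where xyz: "x = \<pi> (0 + 1)" "y = \<pi> (0 + 2)" "z = \<pi> (0 + 3)"
  note l = arc_permutation_letters[OF \<pi> i xyz]
  have empty: "\<pi> ` {1..0} = {}" by simp
  have "cyclic_interval n {y}" "cyclic_interval n {z}"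
    using l(3,4) by (auto intro: cyclic_interval_singleton)
  moreover have "cyclic_interval n {y, z} \<longleftrightarrow> \<not> cyclic_interval n {x, z}"
    using cyclic_interval_triple_pairs[OF n _ l(5-7)] l(9,10) unfolding empty by blast
  ultimately show ?thesis
    by (intro rho_rho_funpow_4[OF \<pi> i xyz]) (unfold empty, simp)
qed

text \<open>Dual to the empty prefix by complementation: adding one letter to \<open>I\<close>
  leaves a pair, adding two leaves a singleton. So \<open>P\<close> always holds, and exactly one of
  \<open>S y\<close> and \<open>S z\<close> does.\<close>

lemma rho_braid_last:
  assumes \<pi>: "\<pi> \<in> arc_permutations n" and n: "4 \<le> n" and i: "i + 3 = n"
  shows "((rho n i \<circ> rho n (i + 1)) ^^ 4) \<pi> = \<pi>"
proof -
  have i3: "i + 3 \<le> n" using i by simp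
  define x y z where xyz: "x = \<pi> (i + 1)" "y = \<pi> (i + 2)" "z = \<pi> (i + 3)"
  note l = arc_permutation_letters[OF \<pi> i3 xyz]
  define I where "I = \<pi> ` {1..i}"
  note l = l[folded I_def]
  have I: "cyclic_interval n I"
    unfolding I_def using i n by (intro arc_permutations_prefix[OF \<pi>]) simp_all
  note sub = cyclic_interval_subset[OF I]
  have "finite I" by (simp add: I_def)
  have "card (I \<union> {x, y, z}) = n"
    using l \<open>finite I\<close> i by (subst card_Un_disjoint) auto
  \<comment> \<open>By cardinality, the three letters are all that \<open>I\<close> misses.\<close>
  then have full: "I \<union> {x, y, z} = {1..n}"
    using l sub by (intro card_subset_eq) auto
  have compl: "{1..n} - I = {x, y, z}" "{1..n} - insert y I = {x, z}"
    "{1..n} - insert x I = {y, z}" "{1..n} - insert z I = {x, y}"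
    "{1..n} - insert y (insert z I) = {x}" "{1..n} - insert x (insert z I) = {y}"
    unfolding full[symmetric] using l(2-7) by auto
  have C: "cyclic_interval n X \<longleftrightarrow> cyclic_interval n Y"
    if "{1..n} - X = Y" "X \<subseteq> {1..n}" "X \<noteq> {}" "Y \<noteq> {}" for X Y
    using that by (subst cyclic_interval_complement_iff[symmetric]) auto
  note C = C[OF compl(2)] C[OF compl(3)] C[OF compl(4)] C[OF compl(5)] C[OF compl(6)]
  have "cyclic_interval n {x, y, z}"
    using cyclic_interval_complement[OF I] compl(1) by auto
  moreover have "cyclic_interval n {y, z}"
    using C(2) l(2,8) sub by simp
  \<comment> \<open>The letters are taken in the order \<open>z\<close>, \<open>y\<close>,
    \<open>x\<close> because \<open>{y, z}\<close>, the complement of \<open>insert x I\<close>, is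
    the pair known to be an arc.\<close>
  ultimately have "cyclic_interval n {x, z} \<longleftrightarrow> \<not> cyclic_interval n {x, y}"
    using cyclic_interval_triple_pairs[OF n, of z y x] l(5-7) by (simp add: insert_commute)
  moreover have "cyclic_interval n (insert y I) \<longleftrightarrow> cyclic_interval n {x, z}"
    "cyclic_interval n (insert z I) \<longleftrightarrow> cyclic_interval n {x, y}"
    using C(1,3) l(3,4) sub by simp_all
  moreover have "cyclic_interval n (insert y (insert z I))" "cyclic_interval n (insert x (insert z I))"
    using C(4,5) l(2-4) sub cyclic_interval_singleton by simp_all
  ultimately show ?thesis
    by (intro rho_rho_funpow_4[OF \<pi> i3 xyz]) (unfold I_def[symmetric], simp)
qed


section \<open>From the Coxeter relations to the group action\<close>

section \<open>The action\<close>

text \<open>Members of \<open>Bij E\<close> are extensional, hence the restriction; an involution is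
  its own inverse witness.\<close>

lemma restrict_involution_in_Bij:
  assumes "\<And>x. x \<in> E \<Longrightarrow> F x \<in> E" "\<And>x. x \<in> E \<Longrightarrow> F (F x) = x"
  shows "restrict F E \<in> Bij E"
proof -
  have "bij_betw F E E"
    by (rule bij_betw_byWitness[of E F F]) (use assms in auto)
  then show ?thesis
    by (simp add: Bij_def bij_betw_cong[of E "restrict F E" F])
qed

text \<open>Multiplication in \<open>BijGroup\<close> is composition, so the last letter of a word
  acts first and each round of the relator contributes \<open>F i \<circ> F j\<close>.\<close>

lemma gword_val_power_relator_BijGroup:
  assumes F: "\<And>l x. l \<in> {i, j} \<Longrightarrow> x \<in> E \<Longrightarrow> F l x \<in> E"
    and bij: "\<And>l. l \<in> {i, j} \<Longrightarrow> restrict (F l) E \<in> Bij E"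
  shows "monoid.gword_val (BijGroup E) (\<lambda>l. restrict (F l) E) (power_relator i j k) =
    restrict ((F i \<circ> F j) ^^ k) E"
proof -
  interpret group "BijGroup E" by (rule group_BijGroup)
  have mult: "g \<otimes>\<^bsub>BijGroup E\<^esub> h = compose E g h" if "g \<in> Bij E" "h \<in> Bij E" for g h
    using that by (simp add: BijGroup_def)
  have one: "\<one>\<^bsub>BijGroup E\<^esub> = restrict id E" by (simp add: BijGroup_def id_def)
  \<comment> \<open>Membership in \<open>Bij E\<close> is carried through the induction, as
    \<open>mult\<close> is available only for such functions.\<close>
  have "gword_val (\<lambda>l. restrict (F l) E) (power_relator i j k) =
      restrict ((F i \<circ> F j) ^^ k) E \<and> restrict ((F i \<circ> F j) ^^ k) E \<in> Bij E"
  proof (induction k)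
    case 0
    have "restrict id E \<in> Bij E" unfolding id_def by (rule id_Bij)
    then show ?case
      by (simp only: funpow.simps power_relator_def replicate.simps concat.simps gword_val_Nil one simp_thms)
  next
    case (Suc k)
    have maps: "((F i \<circ> F j) ^^ k) x \<in> E" if "x \<in> E" for x
      using that by (induction k) (simp_all add: F)
    have eq: "compose E (restrict (F i) E) (compose E (restrict (F j) E) (restrict ((F i \<circ> F j) ^^ k) E)) =
        restrict ((F i \<circ> F j) ^^ Suc k) E"
      by (rule ext) (simp add: compose_def maps F)
    have ij: "restrict (F i) E \<in> Bij E" "restrict (F j) E \<in> Bij E"
      by (simp_all add: bij)
    note c = compose_Bij[OF ij(2) conjunct2[OF Suc.IH]]
    have "power_relator i j (Suc k) = (i, True) # (j, True) # power_relator i j k"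
      by (simp add: power_relator_def)
    then have "gword_val (\<lambda>l. restrict (F l) E) (power_relator i j (Suc k)) =
        restrict ((F i \<circ> F j) ^^ Suc k) E"
      by (simp only: gword_val_Cons if_True conjunct1[OF Suc.IH]
        mult[OF ij(2) conjunct2[OF Suc.IH]] mult[OF ij(1) c] eq)
    with compose_Bij[OF ij(1) c] show ?case unfolding eq by blast
  qed
  then show ?thesis ..
qed

lemma affine_C_relator_acts_trivially:
  assumes n: "4 \<le> n" and r: "r \<in> affine_C_relators (n - 2)" "r \<in> gwords {0..n - 2}"
  shows "monoid.gword_val (BijGroup (arc_permutations n))
    (\<lambda>i. restrict (rho n i) (arc_permutations n)) r = \<one>\<^bsub>BijGroup (arc_permutations n)\<^esub>"
proof -
  let ?A = "arc_permutations n"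
  have power: "monoid.gword_val (BijGroup ?A) (\<lambda>i. restrict (rho n i) ?A) (power_relator i j k) =
      \<one>\<^bsub>BijGroup ?A\<^esub>"
    if "\<And>\<pi>. \<pi> \<in> ?A \<Longrightarrow> ((rho n i \<circ> rho n j) ^^ k) \<pi> = \<pi>" for i j k
  proof -
    have "restrict ((rho n i \<circ> rho n j) ^^ k) ?A = (\<lambda>\<pi>\<in>?A. \<pi>)"
      using that by (intro restrict_ext)
    then show ?thesis
      using gword_val_power_relator_BijGroup[of i j ?A "rho n" k]
      by (simp add: BijGroup_def rho_mem rho_rho restrict_involution_in_Bij)
  qed
  \<comment> \<open>The square of a generator is read as \<open>power_relator i i 1\<close>, so
    every relator is a power. With rank \<open>n - 2\<close>, the bound \<open>i < n - 2 - 1\<close>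
    becomes \<open>i + 4 \<le> n\<close> and the last index satisfies
    \<open>i + 3 = n\<close>.\<close>
  consider i where "r = power_relator i i 1"
    | i j where "i \<le> n - 2" "j \<le> n - 2" "i + 2 \<le> j \<or> j + 2 \<le> i" "r = power_relator i j 2"
    | i where "1 \<le> i" "i + 4 \<le> n" "r = power_relator i (i + 1) 3"
    | "r = power_relator 0 (0 + 1) 4"
    | i where "i + 3 = n" "r = power_relator i (i + 1) 4"
  proof -
    have "r = power_relator i i 1" if "r = [(i, True), (i, True)]" for i
      using that by (simp add: power_relator_def)
    moreover have "i + 2 \<le> j \<or> j + 2 \<le> i" if "\<bar>int j - int i\<bar> > 1" for i j :: nat
      using that by linarith
    moreover have "i + 4 \<le> n" if "i < n - 2 - 1" for i using that by linarith
    moreover have "n - 2 - 1 + 3 = n" using n by simp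
    ultimately show thesis
      using r(1) that unfolding affine_C_relators_def by blast
  qed
  then show ?thesis
  proof cases
    case (1 i)
    show ?thesis unfolding 1 by (rule power) (simp add: rho_rho)
  next
    case (2 i j)
    have ij: "i + 2 \<le> n" "j + 2 \<le> n" using 2 n by simp_all
    have "rho n i (rho n j \<pi>) = rho n j (rho n i \<pi>)" if "\<pi> \<in> ?A" for \<pi>
      using 2(3) rho_commute[OF that _ ij(2)] rho_commute[OF that _ ij(1)] by metis
    then show ?thesis
      unfolding 2 by (intro power) (simp add: eval_nat_numeral rho_rho rho_mem)
  next
    case (3 i)
    then show ?thesis using rho_braid_inner power by blast
  next
    case 4
    then show ?thesis using rho_braid_first[OF _ n] power by blast
  next
    case (5 i)
    then show ?thesis using rho_braid_last[OF _ n] power by blast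
  qed
qed

text \<open>Well-definedness is expressed as existence and uniqueness of an action with prescribed
  generators. The bound on \<open>n\<close> makes the rank at least 2, where the relators describe
  type C.\<close>

theorem proposition10p2:
  fixes n :: nat
  assumes "n \<ge> 4"
  shows "\<exists>!\<phi>. \<phi> \<in> extensional (carrier (affine_C (n - 2)))
    \<and> group_action (affine_C (n - 2)) (arc_permutations n) \<phi>
    \<and> (\<forall>i\<le>n - 2. \<forall>\<pi>\<in>arc_permutations n. \<phi> (affine_C_gen (n - 2) i) \<pi> = rho n i \<pi>)"
proof -
  let ?A = "arc_permutations n" and ?G = "affine_C (n - 2)" and ?s = "affine_C_gen (n - 2)"
  let ?f = "\<lambda>i. restrict (rho n i) ?A"
  interpret group "BijGroup ?A" by (rule group_BijGroup)
  have f: "?f \<in> {0..n - 2} \<rightarrow> carrier (BijGroup ?A)"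
    by (auto simp: BijGroup_def rho_mem rho_rho intro!: restrict_involution_in_Bij)
  have gen: "?s i \<in> carrier ?G" if "i \<le> n - 2" for i
    using pres_class_in_carrier[of "[(i, True)]"] that
    by (simp add: affine_C_gen_def affine_C_def pres_gen_def pres_class_def)
  \<comment> \<open>Images under \<open>\<phi>\<close> are extensional on \<open>?A\<close>, so
    pointwise agreement with \<open>rho\<close> amounts to equality with its restriction, the form
    in the universal property.\<close>
  have "(\<forall>\<pi>\<in>?A. \<phi> (?s i) \<pi> = rho n i \<pi>) \<longleftrightarrow> \<phi> (?s i) = ?f i"
    if "group_hom ?G (BijGroup ?A) \<phi>" "i \<le> n - 2" for \<phi> i
  proof -
    have "\<phi> (?s i) \<in> extensional ?A"
      using group_hom.hom_closed[OF that(1) gen[OF that(2)]]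
      by (simp add: BijGroup_def Bij_imp_extensional)
    then show ?thesis
      by (auto simp: fun_eq_iff extensional_def restrict_def)
  qed
  then have "\<phi> \<in> extensional (carrier ?G) \<and> group_action ?G ?A \<phi> \<and>
      (\<forall>i\<le>n - 2. \<forall>\<pi>\<in>?A. \<phi> (?s i) \<pi> = rho n i \<pi>) \<longleftrightarrow>
    \<phi> \<in> extensional (carrier ?G) \<and> group_hom ?G (BijGroup ?A) \<phi> \<and>
      (\<forall>i\<in>{0..n - 2}. \<phi> (?s i) = ?f i)" for \<phi>
    by (auto simp: group_action_def)
  then show ?thesis
    using presented_group_universal[OF f affine_C_relator_acts_trivially[OF assms]]
    by (simp add: affine_C_def affine_C_gen_def)
qed

end
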